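(* Let $G$ be an abelian group, let $s,n$ be positive integers, let $K$ be a real number with $2\leq K< 2^{-36}\frac{s}{(\log n)^3}$, and let $Y\subset G$ with $|Y|=n$. Then the number of sets $J\subset Y$ with $|J|=s$ and $|J+J|\leq K|J|$ is at most \[ \exp\Big(2^9\lambda K^{1/6}s^{5/6}\sqrt{\log n}\Big)\binom{\frac{1}{2}(Ks+\beta)}{s},\] where $\beta:= \beta\big(Ks+2^6K^{7/6}s^{5/6}\sqrt{\log n}\big)$ and $\lambda:=\min\big\{\frac{K}{K-2},\log s\big\}$ (with $\frac{K}{K-2}=\infty$ when $K=2$).
   Context: $J+J=\{a+b: a,b\in J\}$. For a positive real $t$, $\beta(t)=\max\{|H|: H \text{ a subgroup of } G,\ |H|\leq t\}$ is the size of the largest subgroup of $G$ of size at most $t$. $\log$ denotes the natural logarithm; binomial coefficients $\binom{x}{s}$ with real $x$ are the generalized binomial coefficients $x(x-1)\cdots(x-s+1)/s!$. *)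

theory Defs
  imports Complex_Main
begin

definition sumset :: "'a::ab_group_add set \<Rightarrow> 'a set \<Rightarrow> 'a set" where
  "sumset A B = {a + b | a b. a \<in> A \<and> b \<in> B}"

definition add_subgroup :: "'a::ab_group_add set \<Rightarrow> bool" where
  "add_subgroup H \<longleftrightarrow> 0 \<in> H \<and> (\<forall>x\<in>H. \<forall>y\<in>H. x + y \<in> H) \<and> (\<forall>x\<in>H. - x \<in> H)"

definition beta :: "'a::ab_group_add itself \<Rightarrow> real \<Rightarrow> nat" where
  "beta _ t = Max {card H | H :: 'a set. add_subgroup H \<and> finite H \<and> real (card H) \<le> t}"

end

theory Submission
  imports Defs
begin

text \<open>
  Write $L = \log n$, $m = Ks$, $\varepsilon = K^{1/6} s^{-1/6} \sqrt L$, $\gamma = \varepsilon^2$ and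
  $q = \lceil\sqrt{m/L}\rceil$. For $J$ we keep a pair $(A, B)$ with $A \subseteq J + J$ and $J \subseteq B$,
  starting from $(\emptyset, Y)$. Call $v \in B$ bad if $v + b \notin A$ for more than $\gamma |B|$ of the
  $b \in B$. If $J$ contains a set $T$ of $q$ bad elements, choose greedily $S \subseteq J$ such that each new element
  of $S$ adds at least $\gamma q / 2$ elements to $A' = A \cup (T + S)$; when no further element does, $J$ lies in the
  set $B'$ of those $y \in B$ for which at most $\gamma q/2$ of the sums in $T + y$ are outside $A'$. By double
  counting, $|B \setminus B'| + |A' \setminus A| \ge \gamma |B| / 2$, and since $|A| \le m$ this can only happen
  $O(L / \gamma)$ times while $|B| > m/2$. Each $T$ costs a factor $n^q$ and each element of $S$ a factor $n$,
  which amounts to $\exp(O(L \sqrt{mL} / \gamma)) = \exp(O(\varepsilon s))$ in total.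

  When $J$ has fewer than $q$ bad elements, almost all of $J$ lies in the set $U$ of good elements, and a version of
  Pollard's theorem for abelian groups, applied to $U$ and $B$, gives
  $|U| \le \frac12(m + \beta) + O(\varepsilon m)$. Passing from
  $\binom{\frac12(m+\beta) + O(\varepsilon m)}{s}$ to $\binom{\frac12(m+\beta)}{s}$ costs
  $\exp(O(\lambda \varepsilon s))$.
\<close>

section \<open>Pollard's theorem in abelian groups\<close>

definition rep_count :: "'a::ab_group_add set \<Rightarrow> 'a set \<Rightarrow> 'a \<Rightarrow> nat" where
  "rep_count U V x = card {u \<in> U. x - u \<in> V}"

lemma finite_sumset: "finite A \<Longrightarrow> finite B \<Longrightarrow> finite (sumset A B)"
proof -
  assume "finite A" "finite B"
  then have "finite ((\<lambda>(a,b). a + b) ` (A \<times> B))" by blast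
  moreover have "sumset A B = (\<lambda>(a,b). a + b) ` (A \<times> B)"
    by (auto simp: sumset_def)
  ultimately show ?thesis by simp
qed

lemma sumset_mono: "A \<subseteq> A' \<Longrightarrow> B \<subseteq> B' \<Longrightarrow> sumset A B \<subseteq> sumset A' B'"
  by (auto simp: sumset_def)

text \<open>\<open>beta\<close> is a \<open>Max\<close>, so it is informative only over a finite
  nonempty set: subgroup sizes are at most the floor of \<open>T\<close>, and
  \<open>T \<ge> 1\<close> admits the trivial subgroup.\<close>

lemma
  assumes "T \<ge> 1"
  shows card_le_beta: "\<And>H :: 'a::ab_group_add set.
      \<lbrakk>add_subgroup H; finite H; real (card H) \<le> T\<rbrakk> \<Longrightarrow> card H \<le> beta TYPE('a) T"
    and beta_ge_1: "beta TYPE('a) T \<ge> 1"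
proof -
  let ?S = "{card H | H :: 'a set. add_subgroup H \<and> finite H \<and> real (card H) \<le> T}"
  have "?S \<subseteq> {.. nat \<lfloor>T\<rfloor>}" by (auto simp: le_nat_floor)
  then have fin: "finite ?S" by (rule finite_subset) simp
  have ex: "card {0 :: 'a} \<in> ?S"
    using assms by (intro CollectI exI[of _ "{0}"]) (auto simp: add_subgroup_def)
  show "card H \<le> beta TYPE('a) T"
    if "add_subgroup H" "finite H" "real (card H) \<le> T" for H :: "'a set"
    unfolding beta_def by (rule Max_ge[OF fin]) (use that in blast)
  show "beta TYPE('a) T \<ge> 1"
    unfolding beta_def using Max_ge[OF fin ex] by simp
qed

lemma rep_count_Un_left:
  assumes "finite A" "finite B" "A \<inter> B = {}"
  shows "rep_count (A \<union> B) C x = rep_count A C x + rep_count B C x"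
proof -
  have "{u \<in> A \<union> B. x - u \<in> C} = {u \<in> A. x - u \<in> C} \<union> {u \<in> B. x - u \<in> C}" by auto
  then show ?thesis
    unfolding rep_count_def using assms by (simp add: card_Un_disjoint disjoint_iff)
qed

lemma rep_count_commute: "rep_count A B x = rep_count B A x"
  unfolding rep_count_def
  by (rule bij_betw_same_card[where f = "\<lambda>u. x - u"], rule bij_betw_byWitness[where f' = "\<lambda>u. x - u"]) auto

lemma rep_count_Un_right:
  assumes "finite A" "finite B" "A \<inter> B = {}"
  shows "rep_count C (A \<union> B) x = rep_count C A x + rep_count C B x"
  by (simp add: rep_count_commute[of C] rep_count_Un_left[OF assms])

lemma rep_count_translate:
  "rep_count ((\<lambda>v. v + g) ` A) B x = rep_count A ((\<lambda>v. v + g) ` B) x"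
proof -
  have eq: "y \<in> (\<lambda>v. v + g) ` B \<longleftrightarrow> y - g \<in> B" for y B
    by (auto simp: image_iff intro!: bexI[of _ "y - g"])
  show ?thesis unfolding rep_count_def eq
    by (rule bij_betw_same_card[where f = "\<lambda>u. u - g"], rule bij_betw_byWitness[where f' = "\<lambda>u. u + g"])
      (auto simp: algebra_simps)
qed

lemma rep_count_le:
  assumes "finite B" shows "rep_count A B x \<le> card B"
  unfolding rep_count_commute[of A]
  unfolding rep_count_def using assms by (intro card_mono) auto

lemma card_filter:
  assumes "finite A" shows "card {x \<in> A. P x} = (\<Sum>x\<in>A. if P x then 1 else 0)"
  by (simp add: sum.inter_filter[OF assms, symmetric])

text \<open>Double counting of the pairs \<open>(u, v)\<close> whose sum lies in
  \<open>X\<close>.\<close>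

lemma sum_rep_count:
  assumes "finite X" "finite U"
  shows "(\<Sum>x\<in>X. rep_count U V x) = (\<Sum>u\<in>U. card {v \<in> V. u + v \<in> X})"
proof -
  have "(\<Sum>x\<in>X. rep_count U V x) = (\<Sum>x\<in>X. \<Sum>u\<in>U. if x - u \<in> V then 1 else 0)"
    unfolding rep_count_def by (simp only: card_filter[OF assms(2)])
  also have "\<dots> = (\<Sum>u\<in>U. \<Sum>x\<in>X. if x - u \<in> V then 1 else 0)" by (rule sum.swap)
  also have "\<dots> = (\<Sum>u\<in>U. card {x \<in> X. x - u \<in> V})"
    by (simp only: card_filter[OF assms(1)])
  also have "\<dots> = (\<Sum>u\<in>U. card {v \<in> V. u + v \<in> X})"
  proof (intro sum.cong refl)
    fix u
    show "card {x \<in> X. x - u \<in> V} = card {v \<in> V. u + v \<in> X}"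
      by (rule bij_betw_same_card[where f = "\<lambda>x. x - u"],
          rule bij_betw_byWitness[where f' = "\<lambda>v. u + v"]) auto
  qed
  finally show ?thesis .
qed

text \<open>The terminal case of the induction: no translate of \<open>V\<close> meets \<open>U\<close> without being contained in it.
  Then \<open>U\<close> is a union of cosets of its stabilizer \<open>H\<close>, and \<open>V\<close> lies in a single coset, so
  \<open>card V \<le> card H\<close>; either \<open>card H \<le> beta T\<close>, or \<open>T < card H \<le> card U\<close>.\<close>

lemma pollard_periodic:
  fixes U V :: "'a::ab_group_add set"
  assumes fin: "finite U" "finite V" "finite X" and X: "\<And>u v. u \<in> U \<Longrightarrow> v \<in> V \<Longrightarrow> u + v \<in> X"
    and ne: "U \<noteq> {}" "V \<noteq> {}" and t: "t \<le> card V" and T: "T \<ge> 1"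
    and per: "\<And>u v w. \<lbrakk>u \<in> U; v \<in> V; w \<in> V\<rbrakk> \<Longrightarrow> u + w - v \<in> U"
  shows "real t * min T (real (card U) + real (card V) - real t - real (beta TYPE('a) T))
         \<le> real (\<Sum>x\<in>X. min t (rep_count U V x))"
proof -
  define H where "H = {h. \<forall>u\<in>U. u + h \<in> U}"
  obtain u0 v0 where u0: "u0 \<in> U" and v0: "v0 \<in> V" using ne by auto
  have HU: "(\<lambda>h. u0 + h) ` H \<subseteq> U" using u0 by (auto simp: H_def)
  have finH: "finite H" by (rule finite_imageD[OF finite_subset[OF HU fin(1)]]) (simp add: inj_on_def)
  have cHU: "card H \<le> card U"
    by (rule card_inj_on_le[OF _ HU fin(1)]) (simp add: inj_on_def)
  \<comment> \<open>Translation by \<open>h\<close> is an injective self-map of the finite set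
    \<open>U\<close>, hence onto; this gives inverses although \<open>H\<close> only asks for
    \<open>U + h\<close> inside \<open>U\<close>.\<close>
  have neg: "- h \<in> H" if "h \<in> H" for h
  proof -
    have "(\<lambda>u. u + h) ` U = U"
      using that by (intro endo_inj_surj fin(1)) (auto simp: H_def inj_on_def)
    then have "u - h \<in> U" if "u \<in> U" for u
      using that by (metis (no_types, lifting) add_diff_cancel_right' imageE)
    then show ?thesis by (simp add: H_def)
  qed
  have sub: "add_subgroup H"
    unfolding add_subgroup_def using neg by (auto simp: H_def add.assoc[symmetric])
  have VH: "(\<lambda>v. v - v0) ` V \<subseteq> H" using per v0 by (auto simp: H_def add_diff_eq)
  have cVH: "card V \<le> card H"
    by (rule card_inj_on_le[OF _ VH finH]) (simp add: inj_on_def)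
  \<comment> \<open>Each \<open>v\<close> in \<open>V\<close> gives
    \<open>u + v0 = (u + v0 - v) + v\<close>, whose first summand lies in \<open>U\<close> by
    periodicity. So the cap \<open>t\<close> is attained on all of \<open>U + v0\<close>.\<close>
  have many: "t \<le> rep_count U V (u + v0)" if u: "u \<in> U" for u
  proof -
    have "card V \<le> rep_count U V (u + v0)"
      unfolding rep_count_def
      by (rule card_inj_on_le[where f = "\<lambda>v. u + v0 - v"])
        (use fin u per[OF u _ v0] in \<open>auto simp: inj_on_def algebra_simps\<close>)
    then show ?thesis using t by simp
  qed
  have "t * card U = (\<Sum>x\<in>(\<lambda>u. u + v0) ` U. t)" by (simp add: card_image)
  also have "\<dots> \<le> (\<Sum>x\<in>(\<lambda>u. u + v0) ` U. min t (rep_count U V x))"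
    using many by (intro sum_mono) auto
  also have "\<dots> \<le> (\<Sum>x\<in>X. min t (rep_count U V x))"
    using fin X v0 by (intro sum_mono2) auto
  finally have low: "real t * real (card U) \<le> real (\<Sum>x\<in>X. min t (rep_count U V x))"
    unfolding of_nat_mult[symmetric] of_nat_le_iff .
  have "min T (real (card U) + real (card V) - real t - real (beta TYPE('a) T)) \<le> real (card U)"
  proof (cases "real (card H) \<le> T")
    case True
    then have "card H \<le> beta TYPE('a) T" by (rule card_le_beta[OF T sub finH])
    then show ?thesis using cVH by linarith
  next
    case False
    then show ?thesis using cHU by linarith
  qed
  then have "real t * min T (real (card U) + real (card V) - real t - real (beta TYPE('a) T))
      \<le> real t * real (card U)" by (intro mult_left_mono) auto
  then show ?thesis using low by linarith
qed

text \<open>The e-transform, without translating \<open>V\<close>; keeping the second summand is what makes Pollard's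
  theorem accessible when \<open>card W < t\<close>.\<close>

lemma rep_count_transform:
  fixes U V :: "'a::ab_group_add set" and g :: 'a
  assumes fin: "finite U" "finite V"
  defines "Vg \<equiv> (\<lambda>v. v + g) ` V"
  defines "W \<equiv> {v \<in> V. v + g \<in> U}"
  shows "rep_count U V x = rep_count (U \<union> Vg) W x + rep_count (U - Vg) (V - W) x"
proof -
  have finVg: "finite Vg" "finite W" using fin by (auto simp: Vg_def W_def)
  have I: "U \<inter> Vg = (\<lambda>v. v + g) ` W" by (auto simp: Vg_def W_def)
  have "rep_count U V x = rep_count ((U - Vg) \<union> (U \<inter> Vg)) V x" by (simp add: Un_Diff_Int)
  also have "\<dots> = rep_count (U - Vg) V x + rep_count (U \<inter> Vg) V x"
    using fin by (intro rep_count_Un_left) auto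
  also have "rep_count (U - Vg) V x = rep_count (U - Vg) (W \<union> (V - W)) x"
    by (rule arg_cong[where f = "\<lambda>A. rep_count (U - Vg) A x"]) (auto simp: W_def)
  also have "\<dots> = rep_count (U - Vg) W x + rep_count (U - Vg) (V - W) x"
    using fin finVg by (intro rep_count_Un_right) auto
  also have "rep_count (U \<inter> Vg) V x = rep_count Vg W x"
    unfolding I rep_count_translate by (subst rep_count_commute) (simp add: Vg_def)
  also have "rep_count (U - Vg) W x + rep_count (U - Vg) (V - W) x + rep_count Vg W x
     = rep_count ((U - Vg) \<union> Vg) W x + rep_count (U - Vg) (V - W) x"
    using fin finVg by (subst rep_count_Un_left) auto
  also have "(U - Vg) \<union> Vg = U \<union> Vg" by auto
  finally show ?thesis .
qed

text \<open>Induction on \<open>card V\<close> with \<open>X\<close> fixed. In the non-periodic case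
  a translate of \<open>V\<close> meets \<open>U\<close> without lying inside it, and the transform
  gives two pairs with smaller second sets: \<open>(U \<union> Vg, W)\<close>, of the same total
  size, and \<open>(U - Vg, V - W)\<close>. The first suffices if \<open>t \<le> card W\<close>;
  otherwise the two share the cap \<open>t\<close> as \<open>card W\<close> and
  \<open>t - card W\<close>.\<close>

lemma pollard:
  fixes U V X :: "'a::ab_group_add set"
  assumes "finite U" "finite V" "finite X" and "\<And>u v. u \<in> U \<Longrightarrow> v \<in> V \<Longrightarrow> u + v \<in> X"
    and "t \<le> card U" "t \<le> card V" and T: "T \<ge> 1"
  shows "real t * min T (real (card U) + real (card V) - real t - real (beta TYPE('a) T))
         \<le> real (\<Sum>x\<in>X. min t (rep_count U V x))"
  using assms(1-6)
proof (induction "card V" arbitrary: U V t rule: less_induct)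
  case less
  note fin = less.prems(1-3) and X = less.prems(4)
  define b where "b = real (beta TYPE('a) T)"
  have b0: "b \<ge> 0" by (simp add: b_def)
  show ?case
  proof (cases "t = 0")
    case False
    then have ne: "U \<noteq> {}" "V \<noteq> {}" using less.prems by auto
    show ?thesis
    proof (cases "\<forall>u\<in>U. \<forall>v\<in>V. \<forall>w\<in>V. u + w - v \<in> U")
      case True
      then show ?thesis using less.prems ne T by (intro pollard_periodic) auto
    next
      case False
      then obtain u0 v0 w0 where uvw: "u0 \<in> U" "v0 \<in> V" "w0 \<in> V" "u0 + w0 - v0 \<notin> U" by auto
      \<comment> \<open>This shift carries \<open>v0\<close> to \<open>u0\<close> in
        \<open>U\<close> and \<open>w0\<close> out of \<open>U\<close>, so \<open>W\<close> is a
        nonempty proper subset of \<open>V\<close>.\<close>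
      define g where "g = u0 - v0"
      define Vg where "Vg = (\<lambda>v. v + g) ` V"
      define W where "W = {v \<in> V. v + g \<in> U}"
      have W: "v0 \<in> W" "w0 \<notin> W" "W \<subseteq> V" using uvw by (auto simp: W_def g_def algebra_simps)
      have finW: "finite W" using W(3) fin(2) by (rule finite_subset)
      have finVg: "finite Vg" using fin by (simp add: Vg_def)
      have cW: "card W < card V" "card W > 0"
        using W uvw fin finW by (auto intro!: psubset_card_mono simp: card_gt_0_iff)
      have "U \<inter> Vg = (\<lambda>v. v + g) ` W" by (auto simp: Vg_def W_def)
      then have cI: "card (U \<inter> Vg) = card W" by (simp add: card_image)
      have cVg: "card Vg = card V" by (simp add: Vg_def card_image)
      have cU: "card (U \<union> Vg) + card W = card U + card V"
        using card_Un_Int[OF fin(1) finVg] cI cVg by simp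
      have cU0: "card (U - Vg) = card U - card W" and WU: "card W \<le> card U"
        using card_Diff_subset_Int[of U Vg] fin finVg cI card_mono[of U "U \<inter> Vg"] by auto
      have cV0: "card (V - W) = card V - card W" using finW W by (simp add: card_Diff_subset)
      have rep: "rep_count U V x = rep_count (U \<union> Vg) W x + rep_count (U - Vg) (V - W) x" for x
        unfolding Vg_def W_def by (rule rep_count_transform[OF fin(1,2)])
      \<comment> \<open>The transform creates no new sums: for \<open>u = v1 + g\<close> one has
        \<open>u + v = (v + g) + v1\<close>, and \<open>v + g\<close> is in \<open>U\<close> because
        \<open>v\<close> is in \<open>W\<close>.\<close>
      have X1: "u + v \<in> X" if uv: "u \<in> U \<union> Vg" "v \<in> W" for u v
      proof (cases "u \<in> U")
        case False
        then obtain v1 where "v1 \<in> V" "u = v1 + g" using uv by (auto simp: Vg_def)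
        then show ?thesis using X[of "v + g" v1] uv by (auto simp: W_def algebra_simps)
      qed (use uv X W in auto)
      show ?thesis
      proof (cases "t \<le> card W")
        case True
        have "real t * min T (real (card (U \<union> Vg)) + real (card W) - real t - real (beta TYPE('a) T))
           \<le> real (\<Sum>x\<in>X. min t (rep_count (U \<union> Vg) W x))"
          using fin finVg finW X1 True cU cW less.prems by (intro less.hyps) auto
        also have "\<dots> \<le> real (\<Sum>x\<in>X. min t (rep_count U V x))"
          unfolding of_nat_le_iff rep by (intro sum_mono) auto
        also have "real (card (U \<union> Vg)) + real (card W) = real (card U) + real (card V)"
          using cU by linarith
        finally show ?thesis .
      next
        case False
        \<comment> \<open>The pair with \<open>W\<close> has at most \<open>w < t\<close>
          representations of any point, so its sum is uncapped and equals the full number of pairs;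
          the cap \<open>t - w\<close> is left for the other pair.\<close>
        define w where "w = card W"
        define S where "S = real (card U) + real (card V)"
        define M where "M = min T (S - real t - b)"
        have wt: "w < t" using False by (simp add: w_def)
        have full: "(\<Sum>x\<in>X. rep_count (U \<union> Vg) W x) = card (U \<union> Vg) * w"
        proof -
          have "{v \<in> W. u + v \<in> X} = W" if "u \<in> U \<union> Vg" for u using X1[OF that] by auto
          then show ?thesis
            using fin finVg by (simp add: sum_rep_count w_def)
        qed
        have IH: "real (t - w) * min T (real (card (U - Vg)) + real (card (V - W)) - real (t - w) - real (beta TYPE('a) T))
           \<le> real (\<Sum>x\<in>X. min (t - w) (rep_count (U - Vg) (V - W) x))"
          using fin finVg finW X cW less.prems cU0 cV0 unfolding w_def
          by (intro less.hyps) auto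
        have eq: "real (card (U - Vg)) + real (card (V - W)) - real (t - w) = S - real w - real t"
          using cU0 cV0 WU cW wt by (simp add: w_def S_def of_nat_diff)
        have "real w * (S - real w) + real (t - w) * min T (S - real w - real t - b)
            \<le> real (\<Sum>x\<in>X. rep_count (U \<union> Vg) W x) + real (\<Sum>x\<in>X. min (t - w) (rep_count (U - Vg) (V - W) x))"
        proof -
          have "real (card (U \<union> Vg)) = S - real w" using cU by (simp add: S_def w_def)
          then show ?thesis using IH full unfolding eq b_def by (simp add: mult.commute)
        qed
        also have "\<dots> \<le> real (\<Sum>x\<in>X. min t (rep_count U V x))"
        proof -
          have "rep_count (U \<union> Vg) W x \<le> w" for x
            unfolding w_def by (rule rep_count_le[OF finW])
          note le_w = this
          have "rep_count (U \<union> Vg) W x + min (t - w) (rep_count (U - Vg) (V - W) x) \<le> min t (rep_count U V x)" for x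
            using wt rep[of x] le_w[of x] by linarith
          then show ?thesis
            unfolding of_nat_add[symmetric] sum.distrib[symmetric] of_nat_le_iff by (intro sum_mono)
        qed
        finally have low: "real w * (S - real w) + real (t - w) * min T (S - real w - real t - b)
            \<le> real (\<Sum>x\<in>X. min t (rep_count U V x))" .
        have "real t * M \<le> real w * (S - real w) + real (t - w) * min T (S - real w - real t - b)"
        proof (cases "T \<le> S - real w - real t - b")
          case True
          have "real w * M \<le> real w * (S - real w)"
            using wt b0 by (intro mult_left_mono) (auto simp: M_def)
          moreover have "real (t - w) * M \<le> real (t - w) * T"
            by (intro mult_left_mono) (auto simp: M_def)
          ultimately show ?thesis using True wt by (simp add: of_nat_diff algebra_simps)
        next
          case False
          have "real t * M \<le> real t * (S - real t - b)" by (intro mult_left_mono) (auto simp: M_def)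
          \<comment> \<open>The right side exceeds the left by exactly \<open>w * b\<close>.\<close>
          also have "\<dots> \<le> real w * (S - real w) + real (t - w) * (S - real w - real t - b)"
            using wt b0 by (simp add: of_nat_diff algebra_simps)
          finally show ?thesis using False by simp
        qed
        then show ?thesis using low by (simp add: M_def S_def b_def)
      qed
    qed
  qed simp
qed

text \<open>Pollard's theorem with \<open>t\<close> about \<open>\<epsilon> * card U\<close>. The alternative in which the minimum
  is \<open>T = m + 64 * \<epsilon> * m\<close> would force \<open>card V \<ge> 64 * m\<close>, whereas \<open>card V \<le> 2 * m\<close> because
  a single \<open>u \<in> U\<close> already puts half of \<open>u + V\<close> into \<open>A\<close>.\<close>

lemma popular_set_bound:
  fixes U V A :: "'a::ab_group_add set" and \<epsilon> m :: real
  assumes fin: "finite A" "finite V" and UV: "U \<subseteq> V" and A: "real (card A) \<le> m"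
    and \<epsilon>: "0 < \<epsilon>" "\<epsilon> \<le> 1/2" and m: "m \<ge> 1"
    and miss: "\<And>u. u \<in> U \<Longrightarrow> real (card {v \<in> V. u + v \<notin> A}) \<le> \<epsilon>\<^sup>2 * real (card V)"
  shows "real (card U) \<le> (m + real (beta TYPE('a) (m + 64 * \<epsilon> * m))) / 2 + 1/2 + 2 * \<epsilon> * m"
proof (cases "U = {}")
  case True
  then show ?thesis using \<epsilon> m by simp
next
  case False
  then obtain u0 where u0: "u0 \<in> U" by auto
  have finU: "finite U" using UV fin(2) by (rule finite_subset)
  define T where "T = m + 64 * \<epsilon> * m"
  define b where "b = real (beta TYPE('a) T)"
  define u where "u = real (card U)"
  define v where "v = real (card V)"
  define t where "t = nat \<lceil>\<epsilon> * u\<rceil>"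
  define X where "X = A \<union> sumset U V"
  have finX: "finite X" using fin finU by (simp add: X_def finite_sumset)
  have u_pos: "u > 0" using False finU by (simp add: u_def card_gt_0_iff)
  have uv: "u \<le> v" using UV fin by (simp add: u_def v_def card_mono)
  have T1: "T \<ge> 1" using m \<epsilon> by (simp add: T_def add_increasing2)
  have \<epsilon>sq: "\<epsilon>\<^sup>2 \<le> 1/2"
  proof -
    have "\<epsilon>\<^sup>2 \<le> (1/2)\<^sup>2" using \<epsilon> by (intro power_mono) auto
    then show ?thesis by (simp add: power2_eq_square)
  qed
  have t: "\<epsilon> * u \<le> real t" "real t \<le> \<epsilon> * u + 1" "t \<le> card U"
  proof -
    have "\<epsilon> * u \<ge> 0" using \<epsilon> u_pos by simp
    then show "\<epsilon> * u \<le> real t" "real t \<le> \<epsilon> * u + 1" by (simp_all add: t_def)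
    have "\<epsilon> * u \<le> 1 * u" using \<epsilon> u_pos by (intro mult_right_mono) auto
    then have "\<lceil>\<epsilon> * u\<rceil> \<le> int (card U)" by (simp add: ceiling_le_iff u_def)
    then show "t \<le> card U" unfolding t_def by (simp only: nat_le_iff)
  qed
  have "v - \<epsilon>\<^sup>2 * v \<le> m"
  proof -
    have "card V = card ({x \<in> V. u0 + x \<in> A} \<union> {x \<in> V. u0 + x \<notin> A})"
      by (rule arg_cong[where f = card]) auto
    also have "\<dots> \<le> card {x \<in> V. u0 + x \<in> A} + card {x \<in> V. u0 + x \<notin> A}" by (rule card_Un_le)
    finally have "v \<le> real (card {x \<in> V. u0 + x \<in> A}) + real (card {x \<in> V. u0 + x \<notin> A})"
      unfolding v_def by linarith
    moreover have "card {x \<in> V. u0 + x \<in> A} \<le> card A"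
      by (rule card_inj_on_le[where f = "\<lambda>x. u0 + x"]) (use fin in \<open>auto simp: inj_on_def\<close>)
    ultimately show ?thesis using miss[OF u0] A unfolding v_def by linarith
  qed
  moreover have "\<epsilon>\<^sup>2 * v \<le> 1/2 * v" using \<epsilon>sq uv u_pos by (intro mult_right_mono) auto
  ultimately have v2m: "v \<le> 2 * m" by linarith
  \<comment> \<open>Pollard's lower bound against an upper bound: points of \<open>A\<close>
    contribute at most \<open>t\<close> each, and points outside \<open>A\<close> contribute at most
    the number of missed pairs.\<close>
  have main: "real t * (min T (u + v - real t - b) - m) \<le> \<epsilon>\<^sup>2 * u * v"
  proof -
    have "real t * min T (u + v - real t - b) \<le> real (\<Sum>x\<in>X. min t (rep_count U V x))"
      unfolding u_def v_def b_def
    proof (rule pollard[OF finU fin(2) finX _ t(3) _ T1])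
      show "t \<le> card V" using t(3) UV fin(2) card_mono le_trans by blast
    qed (auto simp: X_def sumset_def)
    also have "(\<Sum>x\<in>X. min t (rep_count U V x))
        = (\<Sum>x\<in>A. min t (rep_count U V x)) + (\<Sum>x\<in>X - A. min t (rep_count U V x))"
      using finX by (subst sum.subset_diff[of A X]) (auto simp: X_def)
    also have "\<dots> \<le> (\<Sum>x\<in>A. t) + (\<Sum>x\<in>X - A. rep_count U V x)"
      by (intro add_mono sum_mono) auto
    also have "\<dots> \<le> t * card A + (\<Sum>x\<in>U. card {y \<in> V. x + y \<notin> A})"
      using finX finU fin by (auto simp: sum_rep_count intro!: sum_mono card_mono)
    finally have "real t * min T (u + v - real t - b)
       \<le> real t * real (card A) + (\<Sum>x\<in>U. real (card {y \<in> V. x + y \<notin> A}))"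
      by simp
    also have "\<dots> \<le> real t * m + (\<Sum>x\<in>U. \<epsilon>\<^sup>2 * v)"
      using A miss unfolding v_def by (intro add_mono mult_left_mono sum_mono) auto
    finally show ?thesis by (simp add: u_def algebra_simps)
  qed
  \<comment> \<open>Otherwise both branches of the minimum exceed \<open>m + \<epsilon> * v\<close>,
    the branch \<open>T\<close> because \<open>v \<le> 2 * m\<close>; multiplying by
    \<open>t \<ge> \<epsilon> * u\<close> contradicts \<open>main\<close>.\<close>
  have D: "u + v - real t - b - m \<le> \<epsilon> * v"
  proof (rule ccontr)
    assume neg: "\<not> ?thesis"
    define D where "D = min T (u + v - real t - b) - m"
    have "D > \<epsilon> * v"
    proof -
      have "\<epsilon> * v \<le> \<epsilon> * (2 * m)" using v2m \<epsilon> by (intro mult_left_mono) auto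
      also have "\<dots> < 64 * \<epsilon> * m" using \<epsilon> m by simp
      finally show ?thesis using neg by (simp add: D_def T_def)
    qed
    moreover have "\<epsilon> * v \<ge> 0" using \<epsilon> uv u_pos by simp
    ultimately have "(\<epsilon> * u) * (\<epsilon> * v) < (\<epsilon> * u) * D" "(\<epsilon> * u) * D \<le> real t * D"
      using \<epsilon> u_pos t by (auto intro!: mult_strict_left_mono mult_right_mono)
    then show False using main by (simp add: D_def power2_eq_square algebra_simps)
  qed
  \<comment> \<open>Trading \<open>v\<close> for the smaller \<open>u\<close> doubles
    \<open>u\<close> on the left. The 1 on the right comes from rounding \<open>t\<close> up, and
    becomes the 1/2 of the claim.\<close>
  have "(1 - \<epsilon>) * u \<le> (1 - \<epsilon>) * v" using uv \<epsilon> by (intro mult_left_mono) auto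
  then have "2 * ((1 - \<epsilon>) * u) \<le> 1 + b + m" using D t(2) by (simp add: algebra_simps)
  moreover have "\<epsilon> * u \<le> \<epsilon> * (2 * m)" using uv v2m \<epsilon> by (intro mult_left_mono) auto
  ultimately show ?thesis unfolding u_def[symmetric] b_def[symmetric] T_def[symmetric]
    by (simp add: field_simps)
qed

section \<open>Refining containers\<close>

definition doubling_sets :: "nat \<Rightarrow> real \<Rightarrow> 'a::ab_group_add set \<Rightarrow> 'a set \<Rightarrow> 'a set set" where
  "doubling_sets s m A B = {J. J \<subseteq> B \<and> card J = s \<and> A \<subseteq> sumset J J \<and> real (card (sumset J J)) \<le> m}"

definition bad_elements :: "real \<Rightarrow> 'a::ab_group_add set \<Rightarrow> 'a set \<Rightarrow> 'a set" where
  "bad_elements \<gamma> A B = {v \<in> B. \<gamma> * real (card B) < real (card {b \<in> B. v + b \<notin> A})}"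

definition refine :: "real \<Rightarrow> 'a::ab_group_add set \<Rightarrow> 'a set \<Rightarrow> 'a set \<Rightarrow> 'a set" where
  "refine \<eta> T A B = {y \<in> B. real (card {t \<in> T. t + y \<notin> A}) \<le> \<eta>}"

text \<open>Count the pairs in \<open>T \<times> B\<close> whose sum misses \<open>A\<close>; each
  bad \<open>t\<close> gives more than \<open>\<gamma> * card B\<close>. For fixed \<open>t\<close>,
  at most \<open>card (B - B')\<close> of them have \<open>b\<close> removed and at most
  \<open>card (A' - A)\<close> have their sum in \<open>A' - A\<close>. The rest miss
  \<open>A'\<close> with \<open>b\<close> in \<open>B'\<close>, at most
  \<open>\<gamma> * q / 2\<close> for each such \<open>b\<close>.\<close>

lemma refine_progress:
  assumes fin: "finite B" "finite A'" and T: "T \<subseteq> bad_elements \<gamma> A B" "card T = q" "q > 0"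
    and B': "B' = refine (\<gamma> * real q / 2) T A' B"
  shows "\<gamma> / 2 * real (card B) \<le> real (card (B - B')) + real (card (A' - A))"
proof -
  define \<eta> where "\<eta> = \<gamma> * real q / 2"
  have finT: "finite T" using T card_gt_0_iff by blast
  have sub: "B' \<subseteq> B" by (auto simp: B' refine_def)
  have finB': "finite B'" using sub fin(1) by (rule finite_subset)
  have split: "card {b \<in> B. t + b \<notin> A}
      \<le> card (B - B') + card (A' - A) + card {b \<in> B'. t + b \<notin> A'}" for t
  proof -
    have "{b \<in> B. t + b \<notin> A}
        \<subseteq> ((B - B') \<union> {b \<in> B. t + b \<in> A' - A}) \<union> {b \<in> B'. t + b \<notin> A'}" by auto
    then have "card {b \<in> B. t + b \<notin> A}
        \<le> card (((B - B') \<union> {b \<in> B. t + b \<in> A' - A}) \<union> {b \<in> B'. t + b \<notin> A'})"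
      using fin finB' by (intro card_mono) auto
    also have "\<dots> \<le> card (B - B') + card {b \<in> B. t + b \<in> A' - A} + card {b \<in> B'. t + b \<notin> A'}"
      by (meson add_mono card_Un_le le_refl le_trans)
    also have "card {b \<in> B. t + b \<in> A' - A} \<le> card (A' - A)"
      by (rule card_inj_on_le[where f = "\<lambda>b. t + b"]) (use fin in \<open>auto simp: inj_on_def\<close>)
    finally show ?thesis by simp
  qed
  have "real q * (\<gamma> * real (card B)) = (\<Sum>t\<in>T. \<gamma> * real (card B))" by (simp add: T)
  also have "\<dots> \<le> (\<Sum>t\<in>T. real (card {b \<in> B. t + b \<notin> A}))"
    using T(1) by (intro sum_mono) (auto simp: bad_elements_def)
  also have "\<dots> \<le> (\<Sum>t\<in>T. real (card (B - B')) + real (card (A' - A)) + real (card {b \<in> B'. t + b \<notin> A'}))"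
    unfolding of_nat_add[symmetric] of_nat_le_iff by (intro sum_mono of_nat_mono split)
  also have "\<dots> = real q * (real (card (B - B')) + real (card (A' - A)))
      + (\<Sum>t\<in>T. real (card {b \<in> B'. t + b \<notin> A'}))"
    by (simp add: sum.distrib T algebra_simps)
  also have "(\<Sum>t\<in>T. real (card {b \<in> B'. t + b \<notin> A'})) = (\<Sum>b\<in>B'. real (card {t \<in> T. t + b \<notin> A'}))"
    unfolding card_filter[OF finB'] card_filter[OF finT] of_nat_sum by (rule sum.swap)
  also have "\<dots> \<le> (\<Sum>b\<in>B'. \<eta>)"
    by (intro sum_mono) (auto simp: B' refine_def \<eta>_def)
  also have "\<dots> = real q * (\<gamma> / 2 * real (card B'))" by (simp add: \<eta>_def)
  finally have "real q * (\<gamma> * real (card B))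
      \<le> real q * (real (card (B - B')) + real (card (A' - A)) + \<gamma> / 2 * real (card B'))"
    by (simp add: distrib_left)
  then have main: "\<gamma> * real (card B) \<le> real (card (B - B')) + real (card (A' - A)) + \<gamma> / 2 * real (card B')"
    using T(3) by simp
  show ?thesis
  proof (cases "\<gamma> \<ge> 0")
    case True
    then have "\<gamma> / 2 * real (card B') \<le> \<gamma> / 2 * real (card B)"
      using card_mono[OF fin(1) sub] by (intro mult_left_mono) auto
    then show ?thesis using main by simp
  next
    case False
    then have "\<gamma> / 2 * real (card B) \<le> 0" by (simp add: mult_nonpos_nonneg)
    then show ?thesis by linarith
  qed
qed

text \<open>An inclusion-maximal admissible \<open>S\<close> replaces the greedy process. If some
  \<open>j\<close> had too many sums outside, \<open>insert j S\<close> would be admissible, so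
  \<open>j\<close> would be in \<open>S\<close>; but then \<open>T + j\<close> already lies in
  \<open>sumset T S\<close>.\<close>

lemma greedy_fingerprint:
  fixes J T A :: "'a::ab_group_add set"
  assumes fin: "finite J" "finite T" and \<eta>: "\<eta> \<ge> 0"
  obtains S where "S \<subseteq> J" "\<eta> * real (card S) \<le> real (card (sumset T S - A))"
    "J \<subseteq> refine \<eta> T (A \<union> sumset T S) J"
proof -
  define \<S> where "\<S> = {S \<in> Pow J. \<eta> * real (card S) \<le> real (card (sumset T S - A))}"
  have "finite \<S>" "{} \<in> \<S>" using fin by (auto simp: \<S>_def)
  then obtain S where S: "S \<in> \<S>" and max: "\<And>S'. \<lbrakk>S' \<in> \<S>; S \<subseteq> S'\<rbrakk> \<Longrightarrow> S = S'"
    using finite_has_maximal2[of \<S> "{}"] by auto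
  have finS: "finite S" using S fin(1) by (auto simp: \<S>_def intro: finite_subset)
  have "real (card {t \<in> T. t + j \<notin> A \<union> sumset T S}) \<le> \<eta>" if j: "j \<in> J" for j
  proof (rule ccontr)
    assume neg: "\<not> ?thesis"
    let ?N = "{t \<in> T. t + j \<notin> A \<union> sumset T S}"
    have "\<eta> * real (card (insert j S)) \<le> \<eta> * (real (card S) + 1)"
      using \<eta> finS by (intro mult_left_mono) (auto simp: card_insert_if)
    also have "\<dots> \<le> real (card (sumset T S - A)) + real (card ?N)"
      using S neg by (simp add: \<S>_def algebra_simps)
    also have "\<dots> = real (card ((sumset T S - A) \<union> (\<lambda>t. t + j) ` ?N))"
      using fin finS by (subst card_Un_disjoint) (auto simp: finite_sumset card_image)
    also have "\<dots> \<le> real (card (sumset T (insert j S) - A))"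
      unfolding of_nat_le_iff using fin finS
      by (intro card_mono finite_Diff finite_sumset) (auto simp: sumset_def)
    finally have "insert j S \<in> \<S>" using S j by (auto simp: \<S>_def)
    then have "j \<in> S" using max by blast
    then have "?N = {}" by (auto simp: sumset_def)
    then show False using neg \<eta> by (metis (no_types, lifting) card.empty of_nat_0)
  qed
  then show ?thesis using S by (intro that[of S]) (auto simp: \<S>_def refine_def)
qed

section \<open>Subset counts and the potential function\<close>

lemma sum_Pow_power_card:
  fixes x :: "'b::comm_semiring_1"
  assumes "finite Y" shows "(\<Sum>S\<in>Pow Y. x ^ card S) = (x + 1) ^ card Y"
  using prod_add[OF assms, of "\<lambda>_. x" "\<lambda>_. 1"] by simp

lemma card_subsets_less_le:
  assumes fin: "finite Y" and n: "card Y \<le> n" "n \<ge> 2"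
  shows "card {Q. Q \<subseteq> Y \<and> card Q < q} \<le> n ^ q"
proof -
  have eq: "card Y choose j \<le> n ^ j" for j
  proof (cases "j \<le> card Y")
    case True
    then have "card Y choose j \<le> card Y ^ j" by (rule binomial_le_pow)
    also have "\<dots> \<le> n ^ j" using n by (intro power_mono) auto
    finally show ?thesis .
  qed (simp add: binomial_eq_0)
  show ?thesis
  proof (induction q)
    case (Suc q)
    have "{Q. Q \<subseteq> Y \<and> card Q < Suc q} = {Q. Q \<subseteq> Y \<and> card Q < q} \<union> {Q. Q \<subseteq> Y \<and> card Q = q}"
      by (auto simp: less_Suc_eq)
    then have "card {Q. Q \<subseteq> Y \<and> card Q < Suc q}
        \<le> card {Q. Q \<subseteq> Y \<and> card Q < q} + card {Q. Q \<subseteq> Y \<and> card Q = q}"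
      by (simp only: card_Un_le)
    also have "\<dots> \<le> n ^ q + n ^ q" using Suc eq[of q] by (simp add: n_subsets[OF fin])
    also have "\<dots> \<le> n ^ Suc q" using n by (simp add: mult_2[symmetric])
    finally show ?case .
  qed simp
qed

text \<open>The base-\<open>n\<close> logarithm of the number of ways to continue from \<open>(A, B)\<close>. The first term pays
  \<open>q + 3\<close> per refinement (\<open>q\<close> for the set \<open>T\<close>, the rest for summing over \<open>S\<close> and for the two ways in
  which a step can end), the second pays 1 per element of \<open>S\<close>.\<close>

definition potential :: "real \<Rightarrow> nat \<Rightarrow> real \<Rightarrow> 'a set \<Rightarrow> 'a set \<Rightarrow> real" where
  "potential \<gamma> q m A B = 2 / \<gamma> * (real q + 3) * (ln (real (card B)) + 2 - 2 * real (card A) / m)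
     + 2 / (\<gamma> * real q) * (m - real (card A)) + real q + 1"

text \<open>The constant 2 in the bracket offsets \<open>2 * card A / m\<close>, so both varying
  terms are nonnegative. The remaining \<open>q + 1\<close> pays for the terminal count
  \<open>n ^ q\<close> and for one factor \<open>n\<close>.\<close>

lemma potential_ge:
  assumes "\<gamma> > 0" "m > 0" "real (card A) \<le> m" "card B \<ge> 1"
  shows "potential \<gamma> q m A B \<ge> real q + 1"
proof -
  have "ln (real (card B)) \<ge> 0" using assms by simp
  moreover have "2 * real (card A) / m \<le> 2" using assms by (simp add: pos_divide_le_eq)
  ultimately have "ln (real (card B)) + 2 - 2 * real (card A) / m \<ge> 0" by linarith
  then have "2 / \<gamma> * (real q + 3) * (ln (real (card B)) + 2 - 2 * real (card A) / m) \<ge> 0"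
    using assms by (intro mult_nonneg_nonneg) auto
  moreover have "2 / (\<gamma> * real q) * (m - real (card A)) \<ge> 0"
    using assms by (intro mult_nonneg_nonneg) auto
  ultimately show ?thesis by (simp add: potential_def)
qed

text \<open>The bracket falls by at least \<open>(b - b') / b + (a' - a) / b\<close>: the logarithm
  gives the first part, and \<open>b > m / 2\<close> the second. Progress makes this at least
  \<open>\<gamma> / 2\<close>, which the prefactor turns into \<open>q + 3\<close>. The growth of
  \<open>A\<close> lowers the second term by at least \<open>\<sigma>\<close>.\<close>

lemma potential_step:
  assumes "\<gamma> > 0" "q > 0" "m > 0" and B: "m / 2 < real (card B)" "finite B" "B' \<subseteq> B" "card B' \<ge> 1"
    and A: "finite A'" "A \<subseteq> A'"
    and progress: "\<gamma> / 2 * real (card B) \<le> real (card (B - B')) + real (card (A' - A))"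
    and \<sigma>: "\<gamma> * real q / 2 * \<sigma> \<le> real (card (A' - A))"
  shows "potential \<gamma> q m A' B' \<le> potential \<gamma> q m A B - (real q + 3) - \<sigma>"
proof -
  define b where "b = real (card B)"
  define b' where "b' = real (card B')"
  define a where "a = real (card A)"
  define a' where "a' = real (card A')"
  have finA: "finite A" using A finite_subset by blast
  have b: "0 < b'" "b' \<le> b" "m / 2 < b" using B by (auto simp: b_def b'_def card_mono)
  have a: "a \<le> a'" "real (card (A' - A)) = a' - a"
    using A finA by (auto simp: a_def a'_def card_mono card_Diff_subset of_nat_diff)
  have bb: "real (card (B - B')) = b - b'"
    using B by (simp add: b_def b'_def card_Diff_subset finite_subset card_mono of_nat_diff)
  have "ln (b' / b) \<le> b' / b - 1" using b by (intro ln_le_minus_one) auto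
  then have "ln b' - ln b \<le> b' / b - 1" using b by (simp add: ln_div)
  moreover have "(a' - a) / b \<le> (a' - a) / (m / 2)"
    using a b assms(3) by (intro divide_left_mono mult_pos_pos) auto
  moreover have "\<gamma> / 2 \<le> (b - b') / b + (a' - a) / b"
    using progress b unfolding bb a b_def[symmetric] by (simp add: add_divide_distrib[symmetric] pos_le_divide_eq)
  moreover have "(b - b') / b = 1 - b' / b" using b by (simp add: diff_divide_distrib)
  moreover have "(a' - a) / (m / 2) = 2 * a' / m - 2 * a / m" by (simp add: diff_divide_distrib algebra_simps)
  ultimately have "\<gamma> / 2 \<le> (ln b + 2 - 2 * a / m) - (ln b' + 2 - 2 * a' / m)" by linarith
  then have "2 / \<gamma> * (real q + 3) * (\<gamma> / 2)
      \<le> 2 / \<gamma> * (real q + 3) * ((ln b + 2 - 2 * a / m) - (ln b' + 2 - 2 * a' / m))"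
    using assms by (intro mult_left_mono) auto
  moreover have "2 / \<gamma> * (real q + 3) * (\<gamma> / 2) = real q + 3" using assms(1) by simp
  ultimately have 1: "2 / \<gamma> * (real q + 3) * (ln b' + 2 - 2 * a' / m) + (real q + 3)
      \<le> 2 / \<gamma> * (real q + 3) * (ln b + 2 - 2 * a / m)"
    unfolding right_diff_distrib[of "2 / \<gamma> * (real q + 3)" "ln b + 2 - 2 * a / m"] by linarith
  have "2 / (\<gamma> * real q) * (\<gamma> * real q / 2 * \<sigma>) \<le> 2 / (\<gamma> * real q) * (a' - a)"
    using \<sigma> assms unfolding a by (intro mult_left_mono) auto
  then have 2: "2 / (\<gamma> * real q) * (m - a') + \<sigma> \<le> 2 / (\<gamma> * real q) * (m - a)"
    using assms(1,2) by (simp add: right_diff_distrib)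
  show ?thesis using 1 2 unfolding potential_def a_def[symmetric] a'_def[symmetric] b_def[symmetric] b'_def[symmetric]
    by linarith
qed

section \<open>The recursion over containers\<close>

lemma finite_doubling_sets: "finite B \<Longrightarrow> finite (doubling_sets s m A B)"
  by (rule finite_subset[of _ "Pow B"]) (auto simp: doubling_sets_def)

text \<open>Guess \<open>Q = J \<inter> D\<close>, at most \<open>n ^ q\<close> choices; then
  \<open>J\<close> is an \<open>s\<close>-subset of \<open>(B - D) \<union> Q\<close>.\<close>

lemma card_few_bad_le:
  assumes fin: "finite B" and n: "card B \<le> n" "n \<ge> 2" and D: "D \<subseteq> B"
    and F: "\<And>x. x \<le> card (B - D) + q \<Longrightarrow> real (x choose s) \<le> F"
  shows "real (card {J. J \<subseteq> B \<and> card J = s \<and> card (J \<inter> D) < q}) \<le> F * real n ^ q"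
proof -
  define \<Q> where "\<Q> = {Q. Q \<subseteq> D \<and> card Q < q}"
  have finD: "finite D" using D fin by (rule finite_subset)
  have fin\<Q>: "finite \<Q>" using finD by (simp add: \<Q>_def)
  have card\<Q>: "card \<Q> \<le> n ^ q"
    unfolding \<Q>_def using card_mono[OF fin D] n by (intro card_subsets_less_le[OF finD]) auto
  have F0: "F \<ge> 0" using F[of 0] by (rule order_trans[rotated]) auto
  have "{J. J \<subseteq> B \<and> card J = s \<and> card (J \<inter> D) < q}
      \<subseteq> (\<Union>Q\<in>\<Q>. {J. J \<subseteq> (B - D) \<union> Q \<and> card J = s})"
    unfolding \<Q>_def by (auto intro!: exI[of _ "_ \<inter> D"])
  then have "card {J. J \<subseteq> B \<and> card J = s \<and> card (J \<inter> D) < q}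
      \<le> card (\<Union>Q\<in>\<Q>. {J. J \<subseteq> (B - D) \<union> Q \<and> card J = s})"
  proof (intro card_mono finite_UN_I fin\<Q>)
    fix Q assume "Q \<in> \<Q>"
    then have "finite ((B - D) \<union> Q)" using fin finD by (auto simp: \<Q>_def intro: finite_subset)
    then show "finite {J. J \<subseteq> (B - D) \<union> Q \<and> card J = s}"
      by (rule finite_subset[rotated, OF finite_Pow_iff[THEN iffD2]]) auto
  qed
  also have "\<dots> \<le> (\<Sum>Q\<in>\<Q>. card {J. J \<subseteq> (B - D) \<union> Q \<and> card J = s})"
    by (rule card_UN_le[OF fin\<Q>])
  finally have "real (card {J. J \<subseteq> B \<and> card J = s \<and> card (J \<inter> D) < q})
      \<le> (\<Sum>Q\<in>\<Q>. real (card {J. J \<subseteq> (B - D) \<union> Q \<and> card J = s}))"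
    unfolding of_nat_sum[symmetric] of_nat_le_iff .
  also have "\<dots> \<le> (\<Sum>Q\<in>\<Q>. F)"
  proof (intro sum_mono)
    fix Q assume Q: "Q \<in> \<Q>"
    then have "finite Q" using finD by (auto simp: \<Q>_def intro: finite_subset)
    then have "finite ((B - D) \<union> Q)" using fin by simp
    moreover have "card ((B - D) \<union> Q) \<le> card (B - D) + q"
      using card_Un_le[of "B - D" Q] Q by (simp add: \<Q>_def)
    ultimately show "real (card {J. J \<subseteq> (B - D) \<union> Q \<and> card J = s}) \<le> F"
      using F by (simp add: n_subsets)
  qed
  also have "\<dots> \<le> F * real n ^ q"
    using card\<Q> F0 by (simp add: mult.commute mult_left_mono flip: of_nat_power)
  finally show ?thesis .
qed

text \<open>The fingerprint is found inside \<open>J\<close>, but the new pair depends only on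
  \<open>T\<close>, \<open>S\<close>, \<open>A\<close> and \<open>B\<close>. The \<open>if\<close>
  keeps only those \<open>S\<close> that add enough sums to pay for their own cost.\<close>

lemma many_bad_cover:
  assumes fin: "finite B" and \<gamma>: "\<gamma> \<ge> 0"
  shows "{J \<in> doubling_sets s m A B. q \<le> card (J \<inter> D)} \<subseteq>
    (\<Union>(T, S) \<in> {T. T \<subseteq> D \<and> card T = q} \<times>
      {S. S \<subseteq> B}. if \<gamma> * real q / 2 * real (card S) \<le> real (card (sumset T S - A))
      then doubling_sets s m (A \<union> sumset T S) (refine (\<gamma> * real q / 2) T (A \<union> sumset T S) B) else {})"
proof
  fix J assume J: "J \<in> {J \<in> doubling_sets s m A B. q \<le> card (J \<inter> D)}"
  then have JB: "J \<subseteq> B" by (auto simp: doubling_sets_def)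
  then have finJ: "finite J" using fin by (rule finite_subset)
  obtain T where T: "T \<subseteq> J \<inter> D" "card T = q"
    using J by (auto elim: obtain_subset_with_card_n)
  have finT: "finite T" using T finJ by (auto intro: finite_subset)
  obtain S where S: "S \<subseteq> J" "\<gamma> * real q / 2 * real (card S) \<le> real (card (sumset T S - A))"
    "J \<subseteq> refine (\<gamma> * real q / 2) T (A \<union> sumset T S) J"
    by (rule greedy_fingerprint[OF finJ finT, of "\<gamma> * real q / 2" A]) (use \<gamma> in auto)
  have "refine (\<gamma> * real q / 2) T (A \<union> sumset T S) J \<subseteq> refine (\<gamma> * real q / 2) T (A \<union> sumset T S) B"
    using JB by (auto simp: refine_def)
  moreover have "sumset T S \<subseteq> sumset J J" using T S by (intro sumset_mono) auto
  ultimately have "J \<in> doubling_sets s m (A \<union> sumset T S) (refine (\<gamma> * real q / 2) T (A \<union> sumset T S) B)"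
    using J S by (auto simp: doubling_sets_def)
  then show "J \<in> (\<Union>(T, S) \<in> {T. T \<subseteq> D \<and> card T = q} \<times> {S. S \<subseteq> B}.
      if \<gamma> * real q / 2 * real (card S) \<le> real (card (sumset T S - A))
      then doubling_sets s m (A \<union> sumset T S) (refine (\<gamma> * real q / 2) T (A \<union> sumset T S) B) else {})"
    using T S JB by (intro UN_I[of "(T, S)"]) auto
qed

text \<open>Either \<open>B\<close> has size at most \<open>m / 2\<close> and is counted directly,
  or \<open>J\<close> has few bad elements and \<open>good\<close> bounds its container, or a pair
  \<open>(T, S)\<close> leads to a refined pair. The induction measure falls when \<open>B\<close>
  shrinks or \<open>A\<close> grows.\<close>

lemma card_doubling_sets_le:
  fixes Y A B :: "'a::ab_group_add set"
  assumes Y: "finite Y" "card Y \<le> n" "n \<ge> 2" and s: "s > 0" and \<gamma>: "\<gamma> > 0" and q: "q > 0" and m: "m > 0"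
    and F: "\<And>x. real x \<le> M \<Longrightarrow> real (x choose s) \<le> F" and M: "m / 2 \<le> M"
    and good: "\<And>A B. \<lbrakk>finite A; real (card A) \<le> m; B \<subseteq> Y\<rbrakk>
      \<Longrightarrow> real (card (B - bad_elements \<gamma> A B)) + real q \<le> M"
    and "B \<subseteq> Y"
  shows "real (card (doubling_sets s m A B)) \<le> F * real n powr potential \<gamma> q m A B"
  using \<open>B \<subseteq> Y\<close>
proof (induction "card B + (nat \<lfloor>m\<rfloor> - card A)" arbitrary: A B rule: less_induct)
  case less
  note BY = \<open>B \<subseteq> Y\<close>
  have finB: "finite B" using BY Y(1) by (rule finite_subset)
  have cB: "card B \<le> n" using card_mono[OF Y(1) BY] Y by simp
  have n: "real n \<ge> 2" "real n > 0" "real n \<ge> 1" using Y by simp_all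
  have F0: "F \<ge> 0" using F[of 0] M m by (intro order_trans[OF _ F[of 0]]) auto
  \<comment> \<open>A single member \<open>J\<close> keeps \<open>A\<close> finite and of size at
    most \<open>m\<close>, and \<open>B\<close> nonempty because \<open>s > 0\<close>; empty
    families are dealt with separately.\<close>
  have bound: "finite A \<and> real (card A) \<le> m \<and> card B \<ge> 1"
    if "J \<in> doubling_sets s m A B" "finite B" for J A B
  proof -
    have J: "J \<subseteq> B" "card J = s" "A \<subseteq> sumset J J" "real (card (sumset J J)) \<le> m"
      using that by (auto simp: doubling_sets_def)
    have "finite (sumset J J)" using J(1) that(2) finite_subset finite_sumset by blast
    then have "finite A" "card A \<le> card (sumset J J)" using J(3) finite_subset card_mono by blast+
    moreover have "card B \<ge> 1" using card_mono[OF that(2) J(1)] J(2) s by simp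
    ultimately show ?thesis using J(4) by linarith
  qed
  show ?case
  proof (cases "doubling_sets s m A B = {}")
    case True
    then show ?thesis using F0 by simp
  next
    case False
    then have finA: "finite A" and cA: "real (card A) \<le> m" and cB1: "card B \<ge> 1"
      using bound finB by blast+
    define p where "p = potential \<gamma> q m A B"
    have p: "p \<ge> real q + 1" unfolding p_def by (rule potential_ge[OF \<gamma> m cA cB1])
    show ?thesis
    proof (cases "real (card B) \<le> m / 2")
      case True
      have "card (doubling_sets s m A B) \<le> card {J. J \<subseteq> B \<and> card J = s}"
        using finB by (intro card_mono) (auto simp: doubling_sets_def)
      also have "\<dots> = card B choose s" by (rule n_subsets[OF finB])
      finally have "real (card (doubling_sets s m A B)) \<le> F"
        using F[of "card B"] True M by linarith
      also have "\<dots> \<le> F * real n powr p"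
        using mult_left_mono[OF ge_one_powr_ge_zero[OF n(3), of p] F0] p by simp
      finally show ?thesis by (simp add: p_def)
    next
      case False
      then have B_big: "m / 2 < real (card B)" by simp
      define D where "D = bad_elements \<gamma> A B"
      have DB: "D \<subseteq> B" by (auto simp: D_def bad_elements_def)
      have finD: "finite D" using DB finB by (rule finite_subset)
      define A' where "A' = (\<lambda>(T, S). A \<union> sumset T S)"
      define B' where "B' = (\<lambda>(T, S). refine (\<gamma> * real q / 2) T (A \<union> sumset T S) B)"
      define ok where "ok = (\<lambda>(T, S). \<gamma> * real q / 2 * real (card S) \<le> real (card (sumset T S - A)))"
      define I where "I = {T. T \<subseteq> D \<and> card T = q} \<times> {S. S \<subseteq> B}"
      define G where "G = (\<lambda>TS. if ok TS then doubling_sets s m (A' TS) (B' TS) else {})"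
      have finI: "finite I" using finD finB by (simp add: I_def)
      have step: "real (card (G (T, S))) \<le> F * real n powr (p - (real q + 3)) * (1 / real n) ^ card S"
        if TS: "(T, S) \<in> I" for T S
      proof (cases "G (T, S) = {}")
        case True
        then show ?thesis using F0 by simp
      next
        case False
        then obtain J where ok: "ok (T, S)" and J: "J \<in> doubling_sets s m (A' (T, S)) (B' (T, S))"
          by (auto simp: G_def split: if_splits)
        have T: "T \<subseteq> bad_elements \<gamma> A B" "card T = q" "S \<subseteq> B" using TS by (auto simp: I_def D_def)
        have B'B: "B' (T, S) \<subseteq> B" by (auto simp: B'_def refine_def)
        then have finB': "finite (B' (T, S))" using finB by (rule finite_subset)
        note bd = bound[OF J finB']
        have AA': "A \<subseteq> A' (T, S)" by (simp add: A'_def)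
        have pr: "\<gamma> / 2 * real (card B) \<le> real (card (B - B' (T, S))) + real (card (A' (T, S) - A))"
          using bd T q by (intro refine_progress[OF finB, where T = T and q = q]) (auto simp: A'_def B'_def)
        \<comment> \<open>Positive progress means that \<open>B\<close> loses or \<open>A\<close>
          gains an element, so the measure drops.\<close>
        have "\<gamma> / 2 * real (card B) > 0" using \<gamma> cB1 by simp
        then have "0 < card (B - B' (T, S)) + card (A' (T, S) - A)" using pr by linarith
        moreover have "card (B - B' (T, S)) = card B - card (B' (T, S))" "card (B' (T, S)) \<le> card B"
          using B'B finB' finB by (simp_all add: card_Diff_subset card_mono)
        moreover have "card (A' (T, S) - A) = card (A' (T, S)) - card A" "card A \<le> card (A' (T, S))"
          using AA' finA bd by (simp_all add: card_Diff_subset card_mono)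
        moreover have "card (A' (T, S)) \<le> nat \<lfloor>m\<rfloor>" using bd by (simp add: le_nat_floor)
        ultimately have dec: "card (B' (T, S)) + (nat \<lfloor>m\<rfloor> - card (A' (T, S))) < card B + (nat \<lfloor>m\<rfloor> - card A)"
          by linarith
        have "real (card (G (T, S))) = real (card (doubling_sets s m (A' (T, S)) (B' (T, S))))"
          using ok by (simp add: G_def)
        also have "\<dots> \<le> F * real n powr potential \<gamma> q m (A' (T, S)) (B' (T, S))"
          using B'B BY by (intro less.hyps[OF dec]) auto
        also have "\<dots> \<le> F * real n powr (p - (real q + 3) - real (card S))"
        proof (intro mult_left_mono powr_mono F0 n(3))
          show "potential \<gamma> q m (A' (T, S)) (B' (T, S)) \<le> p - (real q + 3) - real (card S)"
            unfolding p_def using \<gamma> q m B_big finB B'B bd AA' pr ok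
            by (intro potential_step) (auto simp: ok_def A'_def Un_Diff)
        qed
        also have "real n powr (p - (real q + 3) - real (card S))
            = real n powr (p - (real q + 3)) * (1 / real n) ^ card S"
          unfolding powr_diff[of _ "p - (real q + 3)"] powr_realpow[OF n(2)] by (simp add: power_one_over)
        finally show ?thesis by (simp add: mult.assoc)
      qed
      \<comment> \<open>All sizes of \<open>S\<close> are summed at once: the weight
        \<open>1 / n\<close> per element gives at most \<open>(1 + 1 / n) ^ n\<close>, hence a
        constant below \<open>n ^ 2\<close>.\<close>
      have sumS: "(\<Sum>S\<in>{S. S \<subseteq> B}. (1 / real n) ^ card S) \<le> real n ^ 2"
      proof -
        have "(\<Sum>S\<in>{S. S \<subseteq> B}. (1 / real n) ^ card S) = (1 / real n + 1) ^ card B"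
          using sum_Pow_power_card[OF finB, of "1 / real n"] by (simp add: Pow_def)
        also have "\<dots> \<le> (1 / real n + 1) ^ n" using cB n by (intro power_increasing) auto
        also have "\<dots> \<le> exp 1"
          using exp_ge_one_plus_x_over_n_power_n[of n 1] n by (simp add: add.commute)
        also have "exp (1::real) \<le> 3" by (rule exp_le)
        also have "(3::real) \<le> 2\<^sup>2" by simp
        also have "\<dots> \<le> real n ^ 2" using n by (intro power_mono) auto
        finally show ?thesis .
      qed
      have cT: "real (card {T. T \<subseteq> D \<and> card T = q}) \<le> real n powr real q"
      proof -
        have "card D choose q \<le> n ^ q"
        proof (cases "q \<le> card D")
          case True
          then have "card D choose q \<le> card D ^ q" by (rule binomial_le_pow)
          also have "\<dots> \<le> n ^ q" using card_mono[OF finB DB] cB by (intro power_mono) auto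
          finally show ?thesis .
        qed (simp add: binomial_eq_0)
        then show ?thesis using n by (simp add: n_subsets[OF finD] powr_realpow flip: of_nat_power)
      qed
      have "card {J \<in> doubling_sets s m A B. q \<le> card (J \<inter> D)} \<le> card (\<Union>TS\<in>I. G TS)"
      proof (rule card_mono)
        show "finite (\<Union>TS\<in>I. G TS)"
          using finI finB by (auto simp: G_def B'_def refine_def intro!: finite_doubling_sets)
        show "{J \<in> doubling_sets s m A B. q \<le> card (J \<inter> D)} \<subseteq> (\<Union>TS\<in>I. G TS)"
          using many_bad_cover[OF finB, of \<gamma> s m A q D] \<gamma>
          unfolding I_def G_def ok_def A'_def B'_def by (simp add: case_prod_unfold)
      qed
      also have "\<dots> \<le> (\<Sum>TS\<in>I. card (G TS))" by (rule card_UN_le[OF finI])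
      finally have "real (card {J \<in> doubling_sets s m A B. q \<le> card (J \<inter> D)}) \<le> (\<Sum>TS\<in>I. real (card (G TS)))"
        unfolding of_nat_sum[symmetric] of_nat_le_iff .
      also have "\<dots> \<le> (\<Sum>(T, S)\<in>I. F * real n powr (p - (real q + 3)) * (1 / real n) ^ card S)"
        using step by (intro sum_mono) auto
      also have "\<dots> = real (card {T. T \<subseteq> D \<and> card T = q}) *
          (F * real n powr (p - (real q + 3)) * (\<Sum>S\<in>{S. S \<subseteq> B}. (1 / real n) ^ card S))"
        unfolding I_def sum.cartesian_product[symmetric] by (simp add: sum_distrib_left)
      also have "\<dots> \<le> real n powr real q * (F * real n powr (p - (real q + 3)) * real n ^ 2)"
        using F0 sumS cT by (intro mult_mono mult_left_mono mult_nonneg_nonneg sum_nonneg) auto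
      \<comment> \<open>The exponents are \<open>q\<close> for \<open>T\<close>,
        \<open>p - (q + 3)\<close> for the recursion and 2 for the sum over \<open>S\<close>. The
        spare factor \<open>n\<close> absorbs the split into few and many bad elements.\<close>
      also have "\<dots> = F * real n powr (p - 1)"
      proof -
        have "real n powr real q * (real n powr (p - (real q + 3)) * real n powr 2) = real n powr (p - 1)"
          unfolding powr_add[symmetric] by simp
        then show ?thesis using n by (simp add: mult.left_commute)
      qed
      finally have many: "real (card {J \<in> doubling_sets s m A B. q \<le> card (J \<inter> D)}) \<le> F * real n powr (p - 1)" .
      have "real (card {J. J \<subseteq> B \<and> card J = s \<and> card (J \<inter> D) < q}) \<le> F * real n ^ q"
      proof (rule card_few_bad_le[OF finB cB Y(3) DB])
        fix x assume "x \<le> card (B - D) + q"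
        then have "real x \<le> M" using good[OF finA cA BY] unfolding D_def[symmetric] by linarith
        then show "real (x choose s) \<le> F" by (rule F)
      qed
      also have "\<dots> \<le> F * real n powr (p - 1)"
        unfolding powr_realpow[OF n(2), symmetric] using F0 p n by (intro mult_left_mono powr_mono) auto
      finally have few: "real (card {J. J \<subseteq> B \<and> card J = s \<and> card (J \<inter> D) < q}) \<le> F * real n powr (p - 1)" .
      have "card (doubling_sets s m A B) \<le> card ({J. J \<subseteq> B \<and> card J = s \<and> card (J \<inter> D) < q}
          \<union> {J \<in> doubling_sets s m A B. q \<le> card (J \<inter> D)})"
        using finB by (intro card_mono) (auto simp: doubling_sets_def)
      also have "\<dots> \<le> card {J. J \<subseteq> B \<and> card J = s \<and> card (J \<inter> D) < q}
          + card {J \<in> doubling_sets s m A B. q \<le> card (J \<inter> D)}" by (rule card_Un_le)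
      finally have "real (card (doubling_sets s m A B)) \<le> 2 * (F * real n powr (p - 1))"
        using few many by linarith
      also have "\<dots> \<le> real n * (F * real n powr (p - 1))"
        using n F0 by (intro mult_right_mono) auto
      also have "\<dots> = F * real n powr p"
        using n by (simp add: powr_diff)
      finally show ?thesis by (simp add: p_def)
    qed
  qed
qed

section \<open>Generalized binomial coefficients\<close>

lemma binomial_le_gbinomial:
  assumes "real k \<le> x" "real s \<le> x"
  shows "real (k choose s) \<le> x gchoose s"
proof (cases "s \<le> k")
  case True
  have "(\<Prod>i = 0..<s. real k - real i) \<le> (\<Prod>i = 0..<s. x - real i)"
    using assms True by (intro prod_mono) auto
  then show ?thesis
    unfolding binomial_gbinomial gbinomial_prod_rev by (simp add: divide_right_mono)
next
  case False
  have "0 \<le> (\<Prod>i = 0..<s. x - real i)" using assms by (intro prod_nonneg) auto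
  then show ?thesis using False by (simp add: binomial_eq_0 gbinomial_prod_rev)
qed

text \<open>Factorwise, \<open>x + d - i = (1 + d / (x - i)) * (x - i)\<close>, and
  \<open>1 + z \<le> exp z\<close>.\<close>

lemma gbinomial_add_le:
  assumes x: "real s \<le> x" and d: "0 \<le> (d::real)"
  shows "(x + d) gchoose s \<le> exp (d * (\<Sum>i<s. 1 / (x - real i))) * (x gchoose s)"
proof -
  have "(\<Prod>i = 0..<s. x + d - real i) \<le> (\<Prod>i = 0..<s. exp (d / (x - real i)) * (x - real i))"
  proof (intro prod_mono conjI)
    fix i assume i: "i \<in> {0..<s}"
    then have pos: "x - real i > 0" using x by simp
    show "0 \<le> x + d - real i" using pos d by simp
    have "x + d - real i = (1 + d / (x - real i)) * (x - real i)" using pos by (simp add: field_simps)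
    also have "\<dots> \<le> exp (d / (x - real i)) * (x - real i)"
      using pos by (intro mult_right_mono exp_ge_add_one_self) auto
    finally show "x + d - real i \<le> exp (d / (x - real i)) * (x - real i)" .
  qed
  also have "\<dots> = exp (d * (\<Sum>i<s. 1 / (x - real i))) * (\<Prod>i = 0..<s. x - real i)"
    by (simp add: prod.distrib exp_sum sum_distrib_left lessThan_atLeast0)
  finally show ?thesis
    unfolding gbinomial_prod_rev by (simp add: divide_right_mono)
qed

lemma sum_reciprocal_le_ln:
  assumes "s > 0"
  shows "(\<Sum>i<s. 1 / (real i + 1)) \<le> 1 + ln (real s)"
  using assms
proof (induction s rule: nat_induct_non_zero)
  case (Suc k)
  have "ln (real k / (real k + 1)) \<le> real k / (real k + 1) - 1"
    using Suc.hyps by (intro ln_le_minus_one) auto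
  then have "1 / (real k + 1) \<le> ln (real k + 1) - ln (real k)"
    using Suc.hyps by (simp add: ln_div diff_divide_eq_iff field_simps)
  then show ?case using Suc.IH by (simp add: add.commute)
qed simp

text \<open>Source of the factor \<open>\<lambda>\<close>. From \<open>x - i \<ge> s - i\<close> one
  gets a harmonic sum; for \<open>K > 2\<close>, from \<open>x - i \<ge> (K - 2) * s / 2\<close> one
  gets at most \<open>2 / (K - 2)\<close>. The case \<open>K = 2\<close> stands apart because
  division by zero yields 0, not infinity.\<close>

lemma sum_reciprocal_tail_le:
  assumes s: "s > 0" and K: "2 \<le> K" and x: "K * real s / 2 + 1 / 2 \<le> x" and s3: "ln (real s) \<ge> 3"
  shows "K * (\<Sum>i<s. 1 / (x - real i)) \<le> 6 * (if K = 2 then ln (real s) else min (K / (K - 2)) (ln (real s)))"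
proof -
  define R where "R = (\<Sum>i<s. 1 / (x - real i))"
  have Ks: "real s \<le> K * real s / 2" using mult_right_mono[OF K, of "real s"] by simp
  have "R \<le> (\<Sum>i<s. 1 / (real (s - Suc i) + 1))"
    unfolding R_def
  proof (intro sum_mono divide_left_mono)
    fix i assume "i \<in> {..<s}"
    then have "real (s - Suc i) + 1 = real s - real i" by (simp add: of_nat_diff)
    then show le: "real (s - Suc i) + 1 \<le> x - real i" using Ks x by linarith
    show "0 < (x - real i) * (real (s - Suc i) + 1)"
      by (intro mult_pos_pos less_le_trans[OF _ le]) auto
  qed simp
  also have "\<dots> = (\<Sum>i<s. 1 / (real i + 1))"
    by (rule sum.nat_diff_reindex[of "\<lambda>i. 1 / (real i + 1)"])
  also have "\<dots> \<le> 1 + ln (real s)" by (rule sum_reciprocal_le_ln[OF s])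
  finally have R_ln: "R \<le> 1 + ln (real s)" .
  have R_K: "K * R \<le> 2 * (K / (K - 2))" if "K > 2"
  proof -
    have "R \<le> (\<Sum>i<s. 1 / ((K - 2) * real s / 2))"
      unfolding R_def
    proof (intro sum_mono divide_left_mono)
      fix i assume "i \<in> {..<s}"
      then have "real i \<le> real s" by simp
      then show le: "(K - 2) * real s / 2 \<le> x - real i" using x by (simp add: field_simps)
      show "0 < (x - real i) * ((K - 2) * real s / 2)"
        using that s by (intro mult_pos_pos less_le_trans[OF _ le]) auto
    qed simp
    also have "\<dots> = 2 / (K - 2)" using s by simp
    finally have "K * R \<le> K * (2 / (K - 2))" using K by (intro mult_left_mono) auto
    then show ?thesis by (simp add: mult.commute)
  qed
  have small: "K * R \<le> 6 * ln (real s)" if "K \<le> 3"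
  proof -
    have "K * R \<le> K * (1 + ln (real s))" using R_ln K by (intro mult_left_mono) auto
    also have "\<dots> \<le> 3 * (1 + ln (real s))" using that s3 by (intro mult_right_mono) auto
    finally show ?thesis using s3 by simp
  qed
  have large: "K * R \<le> 6 * ln (real s)" if "K > 3"
  proof -
    have "K / (K - 2) \<le> 3" using that by (simp add: field_simps)
    then show ?thesis using R_K that s3 by simp
  qed
  show ?thesis
  proof (cases "K = 2")
    case True
    then show ?thesis using small unfolding R_def by simp
  next
    case False
    have "K / (K - 2) \<ge> 0" using K by simp
    then have "K * R \<le> 6 * (K / (K - 2))" using R_K False K by linarith
    moreover have "K * R \<le> 6 * ln (real s)" using small large by (cases "K \<le> 3") auto
    ultimately show ?thesis using False unfolding R_def[symmetric] by (simp add: min_def)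
  qed
qed

section \<open>Choice of the parameters\<close>

text \<open>With \<open>q\<close> near \<open>w = sqrt (m / L)\<close> the costs of \<open>T\<close>
  and \<open>S\<close> balance, as \<open>m / w = w * L\<close>. The 22 is 20 + 2:
  \<open>q + 3 \<le> 2 * w\<close> and \<open>ln (card Y) + 2 \<le> 5 * L\<close> give the
  20.\<close>

lemma potential_empty_le:
  assumes m: "m > 0" and L: "L \<ge> 1 / 2" and \<gamma>: "\<gamma> > 0" and Y: "card Y > 0" "ln (real (card Y)) \<le> L"
    and w: "sqrt (m / L) \<ge> 4"
  shows "L * potential \<gamma> (nat \<lceil>sqrt (m / L)\<rceil>) m {} Y \<le> 22 * (sqrt (m * L) * L / \<gamma>) + 2 * sqrt (m * L)"
proof -
  define w where "w = sqrt (m / L)"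
  define q where "q = nat \<lceil>w\<rceil>"
  have w4: "w \<ge> 4" using w by (simp add: w_def)
  then have q: "w \<le> real q" "real q \<le> w + 1" unfolding q_def by linarith+
  have wL: "w * L = sqrt (m * L)"
    using m L by (simp add: w_def real_sqrt_divide real_sqrt_mult field_simps)
  have mw: "m / w = w * L"
    using m L w4 by (simp add: w_def field_simps)
  have "2 / \<gamma> * (real q + 3) * (ln (real (card Y)) + 2) \<le> 2 / \<gamma> * (2 * w) * (5 * L)"
    using q w4 Y L \<gamma> by (intro mult_mono mult_nonneg_nonneg mult_left_mono add_nonneg_nonneg) auto
  moreover have "2 / (\<gamma> * real q) * m \<le> 2 / (\<gamma> * w) * m"
    using q w4 m \<gamma> by (intro mult_right_mono divide_left_mono mult_left_mono mult_pos_pos) auto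
  moreover have "2 / (\<gamma> * w) * m = 2 / \<gamma> * (m / w)" by simp
  ultimately have "potential \<gamma> q m {} Y \<le> 2 / \<gamma> * (2 * w) * (5 * L) + 2 / \<gamma> * (m / w) + 2 * w"
    using q w4 by (simp add: potential_def)
  also have "\<dots> = 22 * (w * L) / \<gamma> + 2 * w" unfolding mw by (simp add: field_simps)
  finally have "L * potential \<gamma> q m {} Y \<le> L * (22 * (w * L) / \<gamma> + 2 * w)"
    using L by (intro mult_left_mono) auto
  also have "\<dots> = 22 * ((w * L) * L / \<gamma>) + 2 * (w * L)" by (simp add: field_simps)
  finally show ?thesis unfolding wL unfolding q_def w_def .
qed

text \<open>\<open>\<epsilon>\<close> solves
  \<open>\<epsilon> * s = sqrt (m * L) * L / \<epsilon>\<^sup>2\<close> with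
  \<open>m = K * s\<close>, balancing the loss in the binomial against the cost of the
  containers.\<close>

lemma exponent_facts:
  fixes K L \<epsilon> :: real
  assumes s: "s > 0" and K: "2 \<le> K" and L: "L \<ge> 1 / 2" and small: "K * L ^ 3 < 2 powr (-36) * real s"
    and \<epsilon>_def: "\<epsilon> = K powr (1/6) * real s powr (-1/6) * sqrt L"
  shows "0 < \<epsilon>" "\<epsilon> < 1 / 64" "\<epsilon> ^ 3 * real s = sqrt (K * real s * L) * L"
    "\<epsilon> * real s = K powr (1/6) * real s powr (5/6) * sqrt L"
    "\<epsilon> * (K * real s) = K powr (7/6) * real s powr (5/6) * sqrt L"
    "ln (real s) \<ge> 3" "K * real s \<ge> 16 * L"
proof -
  show pos: "0 < \<epsilon>" using s K L by (simp add: \<epsilon>_def)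
  have s': "real s > 0" using s by simp
  have c36: "(2::real) powr (-36) = 1 / 2 ^ 36" by (simp add: powr_minus powr_realpow[symmetric] field_simps)
  have e3: "\<epsilon> ^ 3 = K powr (1/2) * real s powr (-1/2) * (sqrt L) ^ 3"
    using K s by (simp add: \<epsilon>_def power_mult_distrib powr_power)
  have e3': "\<epsilon> ^ 3 = sqrt K / sqrt (real s) * (sqrt L * L)"
    unfolding e3 using K s L by (simp add: powr_half_sqrt powr_minus power3_eq_cube inverse_eq_divide)
  show e3s: "\<epsilon> ^ 3 * real s = sqrt (K * real s * L) * L"
    unfolding e3' using s L by (simp add: real_sqrt_mult field_simps)
  have "(\<epsilon> ^ 3)\<^sup>2 = K / real s * (L * L\<^sup>2)"
    unfolding e3' using K s L by (simp add: power_mult_distrib power_divide)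
  moreover have "L * L\<^sup>2 = L ^ 3" by (simp add: power2_eq_square power3_eq_cube)
  moreover have "(\<epsilon> ^ 3)\<^sup>2 = \<epsilon> ^ 6" by (simp flip: power_mult)
  ultimately have "\<epsilon> ^ 6 = K * L ^ 3 / real s" by simp
  \<comment> \<open>The constant \<open>2 powr (-36)\<close> is the sixth power of 1/64.\<close>
  also have "\<dots> < (1 / 64) ^ 6"
    using small s' unfolding c36 by (simp add: pos_divide_less_eq power_divide)
  finally show "\<epsilon> < 1 / 64" by (rule power_less_imp_less_base) simp
  show "\<epsilon> * real s = K powr (1/6) * real s powr (5/6) * sqrt L"
    using s powr_add[of "real s" "-1/6" 1] by (simp add: \<epsilon>_def)
  then show "\<epsilon> * (K * real s) = K powr (7/6) * real s powr (5/6) * sqrt L"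
    using K powr_add[of K "1/6" 1] by (simp add: mult.left_commute)
  have L3: "L ^ 3 \<ge> (1/2) ^ 3" "L ^ 2 \<ge> (1/2) ^ 2" using L by (auto intro!: power_mono)
  have "2 * (1/2) ^ 3 \<le> K * L ^ 3" using K L3 by (intro mult_mono) auto
  then have "real s > 3 ^ 3" using small unfolding c36 by (simp add: power3_eq_cube)
  moreover have "exp (3::real) \<le> 3 ^ 3"
    using power_mono[OF exp_le, of 3] by (simp flip: exp_of_nat_mult)
  ultimately show "ln (real s) \<ge> 3" using s' by (simp add: ln_ge_iff)
  have "K * L ^ 3 \<ge> 2 * (1/4 * L)"
  proof (rule mult_mono[OF K])
    have "1/4 * L \<le> L ^ 2 * L" using L3 L by (intro mult_right_mono) (auto simp: power2_eq_square)
    then show "1/4 * L \<le> L ^ 3" by (simp add: power2_eq_square power3_eq_cube)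
  qed (use K L in auto)
  then have "real s \<ge> 16 * L" using small L unfolding c36 by simp
  also have "real s \<le> K * real s" using K s by simp
  finally show "K * real s \<ge> 16 * L" .
qed

theorem theorem4p1:
  fixes Y :: "'a::ab_group_add set" and s n :: nat and K :: real
  assumes "s > 0" and "n > 0"
    and "2 \<le> K" and "K * (ln (real n))^3 < 2 powr (-36) * real s"
    and "finite Y" and "card Y = n"
  shows "real (card {J. J \<subseteq> Y \<and> card J = s \<and> real (card (sumset J J)) \<le> K * real (card J)})
    \<le> exp (2^9 * (if K = 2 then ln (real s) else min (K / (K - 2)) (ln (real s)))
              * K powr (1/6) * real s powr (5/6) * sqrt (ln (real n)))
      * ((1/2) * (K * real s + real (beta TYPE('a)
            (K * real s + 2^6 * K powr (7/6) * real s powr (5/6) * sqrt (ln (real n)))))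
         gchoose s)"
proof -
  define L where "L = ln (real n)"
  define m where "m = K * real s"
  define l where "l = (if K = 2 then ln (real s) else min (K / (K - 2)) (ln (real s)))"
  define T where "T = m + 2^6 * K powr (7/6) * real s powr (5/6) * sqrt L"
  define N where "N = (1/2) * (m + real (beta TYPE('a) T))"
  have L0: "L \<ge> 0" using assms(2) by (simp add: L_def)
  have ms: "m \<ge> 2 * real s" unfolding m_def using assms(3) by (intro mult_right_mono) auto
  then have m: "m \<ge> 1" "m > 0" using assms(1) by auto
  have "T \<ge> 1" using m L0 by (simp add: T_def add_increasing2)
  then have "beta TYPE('a) T \<ge> 1" by (rule beta_ge_1)
  then have N: "N \<ge> m / 2 + 1 / 2" by (simp add: N_def)
  then have Ns: "N \<ge> real s" using ms by linarith
  have fam: "{J. J \<subseteq> Y \<and> card J = s \<and> real (card (sumset J J)) \<le> K * real (card J)} = doubling_sets s m {} Y"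
    by (auto simp: doubling_sets_def m_def)
  have "real (card (doubling_sets s m {} Y)) \<le> exp (2^9 * l * K powr (1/6) * real s powr (5/6) * sqrt L) * (N gchoose s)"
  proof (cases "n = 1")
    \<comment> \<open>Here \<open>L = 0\<close>, so \<open>m / L\<close> is meaningless; the
      exponential is 1 and the plain binomial count suffices.\<close>
    case True
    have "card (doubling_sets s m {} Y) \<le> card {J. J \<subseteq> Y \<and> card J = s}"
      using assms(5) by (intro card_mono) (auto simp: doubling_sets_def)
    also have "\<dots> = 1 choose s" using n_subsets[OF assms(5)] assms(6) True by simp
    finally have "real (card (doubling_sets s m {} Y)) \<le> real (1 choose s)" by simp
    also have "\<dots> \<le> N gchoose s" using N m Ns by (intro binomial_le_gbinomial) auto
    finally show ?thesis using True by (simp add: L_def)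
  next
    case False
    then have n: "n \<ge> 2" using assms(2) by simp
    have "1 / 2 \<le> ln (2::real)"
      using ln_le_minus_one[of "1/2"] by (simp add: ln_div)
    also have "\<dots> \<le> L" unfolding L_def using n by simp
    finally have L: "L \<ge> 1 / 2" .
    define \<epsilon> where "\<epsilon> = K powr (1/6) * real s powr (-1/6) * sqrt L"
    note \<epsilon> = exponent_facts[OF assms(1,3) L assms(4)[folded L_def] \<epsilon>_def, folded m_def]
    define q where "q = nat \<lceil>sqrt (m / L)\<rceil>"
    define R where "R = (\<Sum>i<s. 1 / (N - real i))"
    have "sqrt (m / L) \<ge> sqrt (4\<^sup>2)"
      using \<epsilon>(7) L by (intro real_sqrt_le_mono) (simp add: pos_le_divide_eq)
    then have w4: "sqrt (m / L) \<ge> 4" by simp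
    have \<epsilon>2: "\<epsilon>\<^sup>2 \<le> 1 / 4096" using power_mono[of \<epsilon> "1/64" 2] \<epsilon> by (simp add: power2_eq_square)
    have root_le: "sqrt (m * L) \<le> \<epsilon> * real s / 2"
    proof -
      have "sqrt (m * L) * (1/2) \<le> sqrt (m * L) * L" using L m by (intro mult_left_mono) auto
      also have "\<dots> = \<epsilon>\<^sup>2 * (\<epsilon> * real s)"
        using \<epsilon>(3) by (simp add: power2_eq_square power3_eq_cube mult.assoc)
      also have "\<dots> \<le> 1 / 4096 * (\<epsilon> * real s)" using \<epsilon>2 \<epsilon>(1) by (intro mult_right_mono) auto
      finally have "sqrt (m * L) * (1/2) \<le> 1 / 4096 * (\<epsilon> * real s)" .
      moreover have "0 \<le> sqrt (m * L)" using m L by simp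
      ultimately show ?thesis by linarith
    qed
    \<comment> \<open>Both \<open>q\<close> and the 1/2 of \<open>popular_set_bound\<close> fit into
      a second \<open>2 * \<epsilon> * m\<close>, which is why the containers are bounded by
      \<open>N + 4 * \<epsilon> * m\<close>.\<close>
    have q: "q > 0" "real q + 1/2 \<le> 2 * \<epsilon> * m"
    proof -
      show "q > 0" using w4 unfolding q_def by linarith
      have "sqrt (m / L) = sqrt (m * L) / L" using L m by (simp add: real_sqrt_divide real_sqrt_mult field_simps)
      also have "\<dots> \<le> (\<epsilon> * real s / 2) / (1/2)"
        using root_le L m \<epsilon>(1) by (intro frac_le) auto
      also have "\<dots> \<le> \<epsilon> * m" using mult_left_mono[OF ms, of \<epsilon>] \<epsilon>(1) by simp
      finally show "real q + 1/2 \<le> 2 * \<epsilon> * m" using w4 unfolding q_def by linarith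
    qed
    have T: "T = m + 64 * \<epsilon> * m" unfolding T_def using \<epsilon>(5) by simp
    have "real (card (doubling_sets s m {} Y))
        \<le> ((N + 4 * \<epsilon> * m) gchoose s) * real n powr potential (\<epsilon>\<^sup>2) q m {} Y"
    proof (rule card_doubling_sets_le[OF assms(5) _ n assms(1) _ q(1) m(2), where M = "N + 4 * \<epsilon> * m"])
      fix x assume "real x \<le> N + 4 * \<epsilon> * m"
      then show "real (x choose s) \<le> (N + 4 * \<epsilon> * m) gchoose s"
        using Ns \<epsilon>(1) m by (intro binomial_le_gbinomial) (auto intro: add_increasing2)
    next
      show "m / 2 \<le> N + 4 * \<epsilon> * m" using N \<epsilon>(1) m by (simp add: add_increasing2)
    next
      fix A B :: "'a set" assume AB: "finite A" "real (card A) \<le> m" "B \<subseteq> Y"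
      have "real (card (B - bad_elements (\<epsilon>\<^sup>2) A B)) \<le> (m + real (beta TYPE('a) (m + 64 * \<epsilon> * m))) / 2 + 1/2 + 2 * \<epsilon> * m"
        using AB assms(5) \<epsilon>(1,2) m
        by (intro popular_set_bound[where A = A and V = B]) (auto simp: bad_elements_def intro: finite_subset)
      then show "real (card (B - bad_elements (\<epsilon>\<^sup>2) A B)) + real q \<le> N + 4 * \<epsilon> * m"
        using q(2) unfolding N_def T by simp
    qed (use assms(6) \<epsilon>(1) in auto)
    \<comment> \<open>24 is 4 * 6, from the enlargement \<open>4 * \<epsilon> * m\<close> and the
      tail bound \<open>6 * l\<close>. 23 is 22 from the potential plus 1 for its lower-order
      term.\<close>
    also have "\<dots> \<le> (exp (24 * l * (\<epsilon> * real s)) * (N gchoose s)) * exp (23 * l * (\<epsilon> * real s))"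
    proof (intro mult_mono)
      have "K * R \<le> 6 * l"
        unfolding R_def l_def using N \<epsilon>(6) by (intro sum_reciprocal_tail_le assms) (auto simp: m_def)
      then have "4 * (\<epsilon> * real s) * (K * R) \<le> 4 * (\<epsilon> * real s) * (6 * l)"
        using \<epsilon>(1) by (intro mult_left_mono) auto
      then have "4 * \<epsilon> * m * R \<le> 24 * l * (\<epsilon> * real s)" by (simp add: m_def mult_ac)
      moreover have Npos: "N gchoose s \<ge> 0" using binomial_le_gbinomial[of 0 N s] Ns by simp
      ultimately have "exp (4 * \<epsilon> * m * R) * (N gchoose s) \<le> exp (24 * l * (\<epsilon> * real s)) * (N gchoose s)"
        by (intro mult_right_mono) auto
      then show "(N + 4 * \<epsilon> * m) gchoose s \<le> exp (24 * l * (\<epsilon> * real s)) * (N gchoose s)"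
        using gbinomial_add_le[OF Ns, of "4 * \<epsilon> * m"] \<epsilon>(1) m unfolding R_def[symmetric] by simp
      show "0 \<le> exp (24 * l * (\<epsilon> * real s)) * (N gchoose s)" using Npos by simp
      have l1: "l \<ge> 1" using \<epsilon>(6) assms(3) by (auto simp: l_def)
      have "L * potential (\<epsilon>\<^sup>2) q m {} Y \<le> 22 * (sqrt (m * L) * L / \<epsilon>\<^sup>2) + 2 * sqrt (m * L)"
        unfolding q_def using m L \<epsilon>(1) assms(2,6) w4
        by (intro potential_empty_le) (auto simp: L_def)
      also have "sqrt (m * L) * L / \<epsilon>\<^sup>2 = \<epsilon> * real s"
        unfolding \<epsilon>(3)[symmetric] using \<epsilon>(1) by (simp add: power2_eq_square power3_eq_cube)
      also have "22 * (\<epsilon> * real s) + 2 * sqrt (m * L) \<le> 23 * 1 * (\<epsilon> * real s)" using root_le by simp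
      also have "\<dots> \<le> 23 * l * (\<epsilon> * real s)" using l1 \<epsilon>(1) by (intro mult_right_mono mult_left_mono) auto
      finally show "real n powr potential (\<epsilon>\<^sup>2) q m {} Y \<le> exp (23 * l * (\<epsilon> * real s))"
        using n by (simp add: powr_def L_def mult.commute)
    qed simp
    also have "\<dots> = exp (47 * l * (\<epsilon> * real s)) * (N gchoose s)"
      by (simp add: exp_add[symmetric] mult.commute mult.left_commute)
    also have "\<dots> \<le> exp (2^9 * l * (\<epsilon> * real s)) * (N gchoose s)"
    proof -
      have "l \<ge> 0" using \<epsilon>(6) assms(3) by (auto simp: l_def)
      then have "47 * l * (\<epsilon> * real s) \<le> 2^9 * l * (\<epsilon> * real s)" using \<epsilon>(1) by (intro mult_right_mono) auto
      moreover have "N gchoose s \<ge> 0" using binomial_le_gbinomial[of 0 N s] Ns by simp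
      ultimately show ?thesis by (intro mult_right_mono) auto
    qed
    finally show ?thesis unfolding \<epsilon>(4) by (simp add: mult.assoc)
  qed
  then show ?thesis unfolding fam N_def T_def l_def L_def m_def .
qed

end
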